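(* Let $H$ be a bipartite graph. Then $H$ is Hölder if and only if $\|\cdot\|_H$ is always a semi-norm (that is, for all index sets $\mathcal{I},\mathcal{J}$, $\|\cdot\|_H$ is a semi-norm on $\mathcal{W}_H(\mathcal{I}\times\mathcal{J})$). Moreover, $H$ is weakly Hölder if and only if $\|\cdot\|_{r(H)}$ is always a norm (that is, for all index sets $\mathcal{I},\mathcal{J}$, $\|\cdot\|_{r(H)}$ is a norm on $\mathcal{W}_{r(H)}(\mathcal{I}\times\mathcal{J})$).
   Context: A bipartite graph is a triple $H=(X,Y;E)$ where $X,Y$ are disjoint finite sets and $E$ is a finite multi-set of elements of $X\times Y$ (multiple edges are allowed; the bipartization $(X,Y)$ is fixed as part of the data). Write $E(H)=E$, with $|E|$ counted with multiplicity. For index sets $\mathcal{I},\mathcal{J}$ let $\mathcal{W}(\mathcal{I}\times\mathcal{J})=\{w:\mathcal{I}\times\mathcal{J}\to\mathbb{R}\}$. For $w\in\mathcal{W}(\mathcal{I}\times\mathcal{J})$ put $$h_H(w)=\sum_{x_a\in\mathcal{I}\ \forall a\in X}\ \sum_{y_b\in\mathcal{J}\ \forall b\in Y}\ \prod_{(u,v)\in E}w(x_u,y_v),\qquad \|w\|_H=|h_H(w)|^{1/|E|},\qquad \|w\|_{r(H)}=h_H(|w|)^{1/|E|},$$ where $|w|$ is the pointwise absolute value. $\mathcal{W}_H(\mathcal{I}\times\mathcal{J})$ and $\mathcal{W}_{r(H)}(\mathcal{I}\times\mathcal{J})$ denote the sets of $w$ with $\|w\|_H<\infty$ and $\|w\|_{r(H)}<\infty$,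 respectively. $H$ is Hölder if for all $\mathcal{I},\mathcal{J}$ and every choice of $\{w_e\in\mathcal{W}(\mathcal{I}\times\mathcal{J}):e\in E(H)\}$, $$\sum_{x_a\in\mathcal{I}\ \forall a\in X}\ \sum_{y_b\in\mathcal{J}\ \forall b\in Y}\ \prod_{e=(u,v)\in E(H)}w_e(x_u,y_v)\le\prod_{e\in E(H)}\|w_e\|_H .$$ $H$ is weakly Hölder if the same holds with the right-hand side replaced by $\prod_{e\in E(H)}\|w_e\|_{r(H)}$. A semi-norm satisfies all norm axioms except possibly that $\|x\|=0$ implies $x=0$. *)

theory Defs
  imports "HOL-Analysis.Analysis" "HOL-Library.Multiset" "HOL-Library.Infinite_Typeclass"
begin

definition bipartite_graph :: "'v set \<Rightarrow> 'v set \<Rightarrow> ('v \<times> 'v) multiset \<Rightarrow> bool" where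
  "bipartite_graph X Y E \<longleftrightarrow>
     finite X \<and> finite Y \<and> X \<inter> Y = {} \<and> set_mset E \<subseteq> X \<times> Y"

text \<open>The \<open>k\<close>-th parallel copy of the edge \<open>e\<close> is represented by \<open>(e, k)\<close>, so that families
  indexed by the edges may assign different functions to parallel edges.\<close>

definition edge_copies :: "('v \<times> 'v) multiset \<Rightarrow> (('v \<times> 'v) \<times> nat) set" where
  "edge_copies E = (SIGMA e : set_mset E. {..<count E e})"

text \<open>Real functions on \<open>I \<times> J\<close> are represented by their extensions by zero, so that
  they form a vector space and equality of representatives is equality on \<open>I \<times> J\<close>.\<close>

definition weights :: "'i set \<Rightarrow> 'j set \<Rightarrow> ('i \<times> 'j \<Rightarrow> real) set" where
  "weights I J = {w. \<forall>p. p \<notin> I \<times> J \<longrightarrow> w p = 0}"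

definition vertex_maps ::
    "'v set \<Rightarrow> 'v set \<Rightarrow> 'i set \<Rightarrow> 'j set \<Rightarrow> (('v \<Rightarrow> 'i) \<times> ('v \<Rightarrow> 'j)) set" where
  "vertex_maps X Y I J = (X \<rightarrow>\<^sub>E I) \<times> (Y \<rightarrow>\<^sub>E J)"

definition hom_term ::
    "('v \<times> 'v) multiset \<Rightarrow> ('i \<times> 'j \<Rightarrow> real) \<Rightarrow> ('v \<Rightarrow> 'i) \<times> ('v \<Rightarrow> 'j) \<Rightarrow> real" where
  "hom_term E w = (\<lambda>(x, y). prod_mset (image_mset (\<lambda>(u, v). w (x u, y v)) E))"

definition edge_term ::
    "('v \<times> 'v) multiset \<Rightarrow> (('v \<times> 'v) \<times> nat \<Rightarrow> 'i \<times> 'j \<Rightarrow> real)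
      \<Rightarrow> ('v \<Rightarrow> 'i) \<times> ('v \<Rightarrow> 'j) \<Rightarrow> real" where
  "edge_term E w = (\<lambda>(x, y). \<Prod>((u, v), k) \<in> edge_copies E. w ((u, v), k) (x u, y v))"

text \<open>Index sets may be infinite; sums over them are unordered sums.\<close>

definition hom_sum ::
    "'v set \<Rightarrow> 'v set \<Rightarrow> ('v \<times> 'v) multiset \<Rightarrow> 'i set \<Rightarrow> 'j set
      \<Rightarrow> ('i \<times> 'j \<Rightarrow> real) \<Rightarrow> real" where
  "hom_sum X Y E I J w = infsum (hom_term E w) (vertex_maps X Y I J)"

definition norm_H ::
    "'v set \<Rightarrow> 'v set \<Rightarrow> ('v \<times> 'v) multiset \<Rightarrow> 'i set \<Rightarrow> 'j set
      \<Rightarrow> ('i \<times> 'j \<Rightarrow> real) \<Rightarrow> real" where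
  "norm_H X Y E I J w = \<bar>hom_sum X Y E I J w\<bar> powr (1 / real (size E))"

definition norm_rH ::
    "'v set \<Rightarrow> 'v set \<Rightarrow> ('v \<times> 'v) multiset \<Rightarrow> 'i set \<Rightarrow> 'j set
      \<Rightarrow> ('i \<times> 'j \<Rightarrow> real) \<Rightarrow> real" where
  "norm_rH X Y E I J w = hom_sum X Y E I J (\<lambda>p. \<bar>w p\<bar>) powr (1 / real (size E))"

text \<open>\<^const>\<open>infsum\<close> is \<open>0\<close> for a sum that does not converge, so finiteness of the
  two norms is expressed by convergence of the sums defining them.\<close>

definition W_H ::
    "'v set \<Rightarrow> 'v set \<Rightarrow> ('v \<times> 'v) multiset \<Rightarrow> 'i set \<Rightarrow> 'j set \<Rightarrow> ('i \<times> 'j \<Rightarrow> real) set" where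
  "W_H X Y E I J = {w \<in> weights I J. hom_term E w summable_on vertex_maps X Y I J}"

definition W_rH ::
    "'v set \<Rightarrow> 'v set \<Rightarrow> ('v \<times> 'v) multiset \<Rightarrow> 'i set \<Rightarrow> 'j set \<Rightarrow> ('i \<times> 'j \<Rightarrow> real) set" where
  "W_rH X Y E I J =
     {w \<in> weights I J. hom_term E (\<lambda>p. \<bar>w p\<bar>) summable_on vertex_maps X Y I J}"

text \<open>The index sets range over all subsets of the types \<open>'i\<close> and \<open>'j\<close>. An infinite norm on
  the right-hand side makes the inequality void; when all norms are finite, the inequality
  includes the convergence of its left-hand side.\<close>

definition hoelder ::
    "'i itself \<Rightarrow> 'j itself \<Rightarrow> 'v set \<Rightarrow> 'v set \<Rightarrow> ('v \<times> 'v) multiset \<Rightarrow> bool" where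
  "hoelder TI TJ X Y E \<longleftrightarrow>
     (\<forall>(I :: 'i set) (J :: 'j set) w.
        (\<forall>e \<in> edge_copies E. w e \<in> W_H X Y E I J) \<longrightarrow>
          edge_term E w summable_on vertex_maps X Y I J \<and>
          infsum (edge_term E w) (vertex_maps X Y I J)
            \<le> (\<Prod>e \<in> edge_copies E. norm_H X Y E I J (w e)))"

definition weakly_hoelder ::
    "'i itself \<Rightarrow> 'j itself \<Rightarrow> 'v set \<Rightarrow> 'v set \<Rightarrow> ('v \<times> 'v) multiset \<Rightarrow> bool" where
  "weakly_hoelder TI TJ X Y E \<longleftrightarrow>
     (\<forall>(I :: 'i set) (J :: 'j set) w.
        (\<forall>e \<in> edge_copies E. w e \<in> W_rH X Y E I J) \<longrightarrow>
          edge_term E w summable_on vertex_maps X Y I J \<and>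
          infsum (edge_term E w) (vertex_maps X Y I J)
            \<le> (\<Prod>e \<in> edge_copies E. norm_rH X Y E I J (w e)))"

definition function_subspace :: "('p \<Rightarrow> real) set \<Rightarrow> bool" where
  "function_subspace V \<longleftrightarrow>
     (\<lambda>_. 0) \<in> V \<and>
     (\<forall>u\<in>V. \<forall>w\<in>V. (\<lambda>p. u p + w p) \<in> V) \<and>
     (\<forall>c. \<forall>w\<in>V. (\<lambda>p. c * w p) \<in> V)"

definition seminorm_on :: "('p \<Rightarrow> real) set \<Rightarrow> (('p \<Rightarrow> real) \<Rightarrow> real) \<Rightarrow> bool" where
  "seminorm_on V N \<longleftrightarrow>
     function_subspace V \<and>
     (\<forall>w\<in>V. 0 \<le> N w) \<and>
     (\<forall>c. \<forall>w\<in>V. N (\<lambda>p. c * w p) = \<bar>c\<bar> * N w) \<and>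
     (\<forall>u\<in>V. \<forall>w\<in>V. N (\<lambda>p. u p + w p) \<le> N u + N w)"

definition norm_on :: "('p \<Rightarrow> real) set \<Rightarrow> (('p \<Rightarrow> real) \<Rightarrow> real) \<Rightarrow> bool" where
  "norm_on V N \<longleftrightarrow> seminorm_on V N \<and> (\<forall>w\<in>V. N w = 0 \<longrightarrow> w = (\<lambda>_. 0))"

end

theory Submission
  imports Defs
begin

text \<open>Write \<open>m\<close> for the number of edges, \<open>h\<close> for \<^const>\<open>hom_sum\<close> and \<open>F(w\<^sub>e)\<close> for the
multilinear form, one weight per edge, that the Hoelder inequality bounds; so \<open>h(w) = F(w, \<dots>, w)\<close>
and \<open>\<parallel>w\<parallel>\<^sub>H\<close> raised to the power \<open>m\<close> is the absolute value of \<open>h(w)\<close>.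

\<^bold>\<open>From Hoelder to the triangle inequality.\<close> Expanding each factor of \<open>h(u + w)\<close> gives a sum over all
ways to choose \<open>u\<close> or \<open>w\<close> at every edge. Bounding each summand by the Hoelder inequality yields
\<open>(\<parallel>u\<parallel> + \<parallel>w\<parallel>) ^ m\<close> (\<open>hom_term_add_bound\<close>). That \<open>h(u + w)\<close> may be negative does no harm, since the
sign of \<open>F\<close> can be flipped at a single edge without changing any norm (\<open>hoelder_abs_bound\<close>). In the
weak case, the constant vertex maps contribute \<open>\<bar>w(i, j)\<bar> ^ m\<close> to \<open>h(\<bar>w\<bar>)\<close>, which makes the seminorm
definite.

\<^bold>\<open>From the triangle inequality to Hoelder.\<close> Tensor powers do the work: both \<open>F\<close> and the norm are
multiplicative under tensor products. Scale the weights to norm at most \<open>1\<close>. Expanding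
\<open>h(\<Sum>\<^sub>e w\<^sub>e \<otimes> w\<^sub>e)\<close> produces one term \<open>F(w\<^bsub>c(e)\<^esub>)\<^sup>2\<close> for each map \<open>c\<close> from edges to edges. As squares
these are all nonnegative, so the term of the identity map, \<open>F(w\<^sub>e)\<^sup>2\<close>, is at most
\<open>h(\<Sum>\<^sub>e w\<^sub>e \<otimes> w\<^sub>e)\<close>, which the triangle inequality bounds by \<open>m ^ m\<close>. Applying this
to \<open>w\<^sub>e \<otimes> w\<^sub>e\<close> instead of \<open>w\<^sub>e\<close>, over and over, bounds arbitrarily high powers of \<open>F(w\<^sub>e)\<close> by the same
constant \<open>m ^ m\<close>, and so \<open>F(w\<^sub>e) \<le> 1\<close>
(\<open>edge_form_power_bound\<close>, \<open>triangle_imp_hoelder_on_nat\<close>).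

\<^bold>\<open>Reduction to finite index sets.\<close> The Hoelder property and the triangle inequality are compared for
finite sets of natural numbers. A finite set embeds into every infinite type, so statements about
all finite index sets do not depend on the index types. The passage from finite to arbitrary
index sets is a limit over the finite subsets: the vertex maps into finite subsets of \<open>I\<close> and
\<open>J\<close> exhaust all vertex maps. Absolute convergence, needed before the limit can be
taken, comes from the finite Hoelder inequality for the absolute values of the weights
(\<open>edge_term_summable\<close>).

Both halves of the theorem are instances of one argument, run for weights with values in a set \<open>C\<close>
of reals: \<open>C = UNIV\<close> for the Hoelder property and \<open>C = {0..}\<close> for its weak form. The second choice is
adequate because \<open>\<parallel>w\<parallel>\<^bsub>r(H)\<^esub>\<close> is the norm \<open>\<parallel>\<cdot>\<parallel>\<^sub>H\<close> of the nonnegative weight \<open>\<bar>w\<bar>\<close>.\<close>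

section \<open>The multilinear form of a bipartite graph\<close>

definition edge_form ::
    "'v set \<Rightarrow> 'v set \<Rightarrow> ('v \<times> 'v) multiset \<Rightarrow> 'i set \<Rightarrow> 'j set
      \<Rightarrow> (('v \<times> 'v) \<times> nat \<Rightarrow> 'i \<times> 'j \<Rightarrow> real) \<Rightarrow> real" where
  "edge_form X Y E I J w = (\<Sum>z\<in>vertex_maps X Y I J. edge_term E w z)"

text \<open>The Hoelder inequality for one pair of index sets and weights with values in \<open>C\<close>. The weights are
arbitrary outside \<open>I \<times> J\<close>, which lets them be pulled back along maps of index sets without
care for their supports. This and the next notion are used for finite index sets, where every sum
converges.\<close>
definition hoelder_on ::
    "real set \<Rightarrow> 'v set \<Rightarrow> 'v set \<Rightarrow> ('v \<times> 'v) multiset \<Rightarrow> 'i set \<Rightarrow> 'j set \<Rightarrow> bool" where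
  "hoelder_on C X Y E I J \<longleftrightarrow>
     (\<forall>w. (\<forall>e\<in>edge_copies E. \<forall>p. w e p \<in> C) \<longrightarrow>
       edge_form X Y E I J w \<le> (\<Prod>e\<in>edge_copies E. norm_H X Y E I J (w e)))"

definition triangle_on ::
    "real set \<Rightarrow> 'v set \<Rightarrow> 'v set \<Rightarrow> ('v \<times> 'v) multiset \<Rightarrow> 'i set \<Rightarrow> 'j set \<Rightarrow> bool" where
  "triangle_on C X Y E I J \<longleftrightarrow>
     (\<forall>u w. (\<forall>p. u p \<in> C) \<longrightarrow> (\<forall>p. w p \<in> C) \<longrightarrow>
       norm_H X Y E I J (\<lambda>p. u p + w p) \<le> norm_H X Y E I J u + norm_H X Y E I J w)"

lemma finite_edge_copies [simp]: "finite (edge_copies E)"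
  unfolding edge_copies_def by auto

lemma card_edge_copies: "card (edge_copies E) = size E"
  unfolding edge_copies_def by (simp add: size_multiset_overloaded_eq)

text \<open>Placing the same weight on all edge copies recovers the homomorphism term, so that facts about
families of weights specialise to a single weight.\<close>
lemma edge_term_const: "edge_term E (\<lambda>_. w) = hom_term E w"
proof
  fix z :: "('a \<Rightarrow> 'b) \<times> ('a \<Rightarrow> 'c)"
  obtain x y where z: "z = (x, y)" by (cases z)
  have "edge_term E (\<lambda>_. w) z
      = (\<Prod>e\<in>set_mset E. \<Prod>k<count E e. w (x (fst e), y (snd e)))"
    unfolding edge_term_def edge_copies_def z
    by (subst prod.Sigma) (auto simp: case_prod_unfold)
  also have "\<dots> = hom_term E w z"
    unfolding hom_term_def z by (simp add: image_prod_mset_multiplicity case_prod_unfold)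
  finally show "edge_term E (\<lambda>_. w) z = hom_term E w z" .
qed

lemma edge_term_eq:
  "edge_term E w z
     = (\<Prod>e\<in>edge_copies E. w e (fst z (fst (fst e)), snd z (snd (fst e))))"
  unfolding edge_term_def by (simp add: case_prod_unfold)

lemma edge_term_cong:
  assumes "\<And>e. e \<in> edge_copies E \<Longrightarrow> w e = w' e"
  shows "edge_term E w = edge_term E w'"
  using assms by (intro ext) (simp add: edge_term_eq)

lemma edge_ends:
  assumes "bipartite_graph X Y E" "e \<in> edge_copies E"
  shows "fst (fst e) \<in> X" "snd (fst e) \<in> Y"
  using assms unfolding bipartite_graph_def edge_copies_def by auto

lemma edge_copies_nonempty: "E \<noteq> {#} \<Longrightarrow> edge_copies E \<noteq> {}"
  using card_edge_copies[of E] by auto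

lemma edge_term_weights_cong:
  assumes H: "bipartite_graph X Y E" and z: "z \<in> vertex_maps X Y I J"
    and eq: "\<And>e p. e \<in> edge_copies E \<Longrightarrow> p \<in> I \<times> J \<Longrightarrow> w e p = w' e p"
  shows "edge_term E w z = edge_term E w' z"
  unfolding edge_term_eq
proof (rule prod.cong[OF refl])
  fix e assume e: "e \<in> edge_copies E"
  have "(fst z (fst (fst e)), snd z (snd (fst e))) \<in> I \<times> J"
    using z edge_ends[OF H e] unfolding vertex_maps_def by auto
  then show "w e (fst z (fst (fst e)), snd z (snd (fst e)))
      = w' e (fst z (fst (fst e)), snd z (snd (fst e)))"
    using eq e by blast
qed

lemma hom_term_weights_cong:
  assumes "bipartite_graph X Y E" "z \<in> vertex_maps X Y I J"
    and "\<And>p. p \<in> I \<times> J \<Longrightarrow> w p = w' p"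
  shows "hom_term E w z = hom_term E w' z"
  using edge_term_weights_cong[of X Y E z I J "\<lambda>_. w" "\<lambda>_. w'"] assms
  by (simp add: edge_term_const)

lemma norm_H_weights_cong:
  assumes "bipartite_graph X Y E"
    and "\<And>p. p \<in> I \<times> J \<Longrightarrow> w p = w' p"
  shows "norm_H X Y E I J w = norm_H X Y E I J w'"
proof -
  have "hom_sum X Y E I J w = hom_sum X Y E I J w'"
    unfolding hom_sum_def using assms by (intro infsum_cong hom_term_weights_cong) auto
  then show ?thesis by (simp add: norm_H_def)
qed

lemma finite_vertex_maps:
  assumes "bipartite_graph X Y E" "finite I" "finite J"
  shows "finite (vertex_maps X Y I J)"
  using assms unfolding bipartite_graph_def vertex_maps_def by (auto intro!: finite_PiE)

lemma hom_sum_eq_edge_form: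
  assumes "bipartite_graph X Y E" "finite I" "finite J"
  shows "hom_sum X Y E I J w = edge_form X Y E I J (\<lambda>_. w)"
  unfolding hom_sum_def edge_form_def edge_term_const
  using finite_vertex_maps[OF assms] by simp

lemma norm_H_nonneg: "0 \<le> norm_H X Y E I J w"
  by (simp add: norm_H_def)

lemma norm_H_power:
  assumes "E \<noteq> {#}"
  shows "norm_H X Y E I J w ^ size E = \<bar>hom_sum X Y E I J w\<bar>"
proof -
  have "size E > 0" using assms by (simp add: nonempty_has_size)
  show ?thesis
  proof (cases "hom_sum X Y E I J w = 0")
    case True
    then show ?thesis using \<open>size E > 0\<close> by (simp add: norm_H_def)
  next
    case False
    then have "norm_H X Y E I J w ^ size E = norm_H X Y E I J w powr real (size E)"
      by (intro powr_realpow[symmetric]) (simp add: norm_H_def)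
    also have "\<dots> = \<bar>hom_sum X Y E I J w\<bar>"
      using False assms by (simp add: norm_H_def powr_powr)
    finally show ?thesis .
  qed
qed

lemma norm_H_le_iff:
  assumes "E \<noteq> {#}" "0 \<le> a"
  shows "norm_H X Y E I J w \<le> a \<longleftrightarrow> \<bar>hom_sum X Y E I J w\<bar> \<le> a ^ size E"
proof -
  have "size E > 0" using assms by (simp add: nonempty_has_size)
  then show ?thesis
    using power_mono_iff[OF norm_H_nonneg assms(2), of "size E" X Y E I J w] assms
    by (simp add: norm_H_power)
qed

lemma hom_term_scale: "hom_term E (\<lambda>p. c * w p) z = c ^ size E * hom_term E w z"
  by (simp add: edge_term_eq prod.distrib card_edge_copies flip: edge_term_const)

lemma norm_H_scale:
  assumes "E \<noteq> {#}"
  shows "norm_H X Y E I J (\<lambda>p. c * w p) = \<bar>c\<bar> * norm_H X Y E I J w"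
proof -
  have "size E > 0" using assms by (simp add: nonempty_has_size)
  have "hom_sum X Y E I J (\<lambda>p. c * w p) = c ^ size E * hom_sum X Y E I J w"
    unfolding hom_sum_def hom_term_scale by (rule infsum_cmult_right')
  then have "norm_H X Y E I J (\<lambda>p. c * w p) ^ size E
      = (\<bar>c\<bar> * norm_H X Y E I J w) ^ size E"
    using assms by (simp add: norm_H_power power_mult_distrib abs_mult power_abs)
  then show ?thesis
    using \<open>size E > 0\<close> by (simp add: power_eq_iff_eq_base norm_H_nonneg)
qed

lemma norm_H_zero:
  assumes "E \<noteq> {#}"
  shows "norm_H X Y E I J (\<lambda>_. 0) = 0"
  using norm_H_scale[OF assms, of X Y I J 0 "\<lambda>_. 0"] by simp

text \<open>Multilinearity: a product of sums expands into a sum over choice functions \<open>c\<close>. Both directions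
of the theorem rest on this expansion.\<close>
lemma edge_term_sum:
  assumes "finite A"
  shows "edge_term E (\<lambda>e p. \<Sum>i\<in>A. f i e p) z
    = (\<Sum>c\<in>edge_copies E \<rightarrow>\<^sub>E A. edge_term E (\<lambda>e. f (c e) e) z)"
  unfolding edge_term_eq using assms
  by (subst prod_sum_PiE) auto

lemma edge_term_abs: "edge_term E (\<lambda>e p. \<bar>w e p\<bar>) z = \<bar>edge_term E w z\<bar>"
  by (simp add: edge_term_eq abs_prod)

lemma hom_term_abs: "hom_term E (\<lambda>p. \<bar>w p\<bar>) z = \<bar>hom_term E w z\<bar>"
  using edge_term_abs[of E "\<lambda>_. w" z] by (simp add: edge_term_const)

section \<open>Change of index sets and tensor squares\<close>
lemma edge_form_reindex:
  assumes H: "bipartite_graph X Y E" and f: "inj_on f I" and g: "inj_on g J"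
  shows "edge_form X Y E (f ` I) (g ` J) w
       = edge_form X Y E I J (\<lambda>e p. w e (f (fst p), g (snd p)))"
  unfolding edge_form_def
proof (rule sum.reindex_bij_witness
    [where i = "\<lambda>(x, y). (\<lambda>a\<in>X. f (x a), \<lambda>b\<in>Y. g (y b))"
       and j = "\<lambda>(x, y). (\<lambda>a\<in>X. inv_into I f (x a), \<lambda>b\<in>Y. inv_into J g (y b))"],
    goal_cases)
  case (1 z)
  then show ?case
    by (auto simp: vertex_maps_def PiE_def Pi_def extensional_def restrict_def f_inv_into_f
        intro!: ext)
next
  case (2 z)
  then show ?case
    by (auto simp: vertex_maps_def PiE_def Pi_def intro!: inv_into_into)
next
  case (3 z)
  then show ?case
    by (auto simp: vertex_maps_def PiE_def Pi_def extensional_def restrict_def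
        inv_into_f_f[OF f] inv_into_f_f[OF g] intro!: ext)
next
  case (4 z)
  then show ?case
    by (auto simp: vertex_maps_def)
next
  case (5 z)
  then show ?case
    using edge_ends[OF H]
    by (auto simp: vertex_maps_def edge_term_eq PiE_def Pi_def f_inv_into_f intro!: prod.cong)
qed

lemma norm_H_reindex:
  assumes "bipartite_graph X Y E" "finite I" "finite J" "inj_on f I" "inj_on g J"
  shows "norm_H X Y E (f ` I) (g ` J) w = norm_H X Y E I J (\<lambda>p. w (f (fst p), g (snd p)))"
  using assms by (simp add: norm_H_def hom_sum_eq_edge_form edge_form_reindex)

text \<open>The tensor square of a weight on \<open>I \<times> J\<close> lives on \<open>(I \<times> I) \<times> (J \<times> J)\<close>. Coding pairs of indices as
numbers keeps the index types unchanged, which makes the construction iterable inside an induction.\<close>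
definition tensor_square :: "(nat \<times> nat \<Rightarrow> real) \<Rightarrow> nat \<times> nat \<Rightarrow> real" where
  "tensor_square w = (\<lambda>(i, j).
     w (fst (prod_decode i), fst (prod_decode j)) * w (snd (prod_decode i), snd (prod_decode j)))"

text \<open>A vertex map into pairs of indices is a pair of vertex maps, so the sum for the tensor square is
the product of two copies of the original sum.\<close>
lemma edge_form_tensor_square:
  assumes H: "bipartite_graph X Y E"
  shows "edge_form X Y E (prod_encode ` (I \<times> I)) (prod_encode ` (J \<times> J)) (\<lambda>e. tensor_square (w e))
       = (edge_form X Y E I J w)\<^sup>2"
proof -
  have "(edge_form X Y E I J w)\<^sup>2
      = (\<Sum>(z, z')\<in>vertex_maps X Y I J \<times> vertex_maps X Y I J. edge_term E w z * edge_term E w z')"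
    unfolding edge_form_def power2_eq_square sum_product sum.cartesian_product ..
  also have "\<dots> = edge_form X Y E (prod_encode ` (I \<times> I)) (prod_encode ` (J \<times> J))
      (\<lambda>e. tensor_square (w e))"
    unfolding edge_form_def
  proof (rule sum.reindex_bij_witness
      [where j = "\<lambda>((x, y), (x', y')). (\<lambda>a\<in>X. prod_encode (x a, x' a), \<lambda>b\<in>Y. prod_encode (y b, y' b))"
         and i = "\<lambda>(x, y). ((\<lambda>a\<in>X. fst (prod_decode (x a)), \<lambda>b\<in>Y. fst (prod_decode (y b))),
                            (\<lambda>a\<in>X. snd (prod_decode (x a)), \<lambda>b\<in>Y. snd (prod_decode (y b))))"],
      goal_cases)
    case (1 z)
    then show ?case
      by (auto simp: vertex_maps_def PiE_def Pi_def extensional_def restrict_def intro!: ext)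
  next
    case (2 z)
    then show ?case by (auto simp: vertex_maps_def PiE_def Pi_def)
  next
    case (3 z)
    then show ?case
      by (auto simp: vertex_maps_def PiE_def Pi_def extensional_def restrict_def intro!: ext)
  next
    case (4 z)
    then show ?case
      by (fastforce simp: vertex_maps_def PiE_def Pi_def)
  next
    case (5 z)
    then show ?case
      using edge_ends[OF H]
      by (auto simp: edge_term_eq tensor_square_def simp flip: prod.distrib intro!: prod.cong)
  qed
  finally show ?thesis ..
qed

lemma norm_H_tensor_square:
  assumes H: "bipartite_graph X Y E" and E: "E \<noteq> {#}" and fin: "finite I" "finite J"
  shows "norm_H X Y E (prod_encode ` (I \<times> I)) (prod_encode ` (J \<times> J)) (tensor_square w)
       = (norm_H X Y E I J w)\<^sup>2" (is "?l = ?r")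
proof -
  have "?l ^ size E = \<bar>(edge_form X Y E I J (\<lambda>_. w))\<^sup>2\<bar>"
    using E by (simp only: norm_H_power[OF E] hom_sum_eq_edge_form[OF H] fin finite_imageI
        finite_cartesian_product edge_form_tensor_square[OF H])
  also have "\<dots> = (norm_H X Y E I J w ^ size E)\<^sup>2"
    by (simp add: norm_H_power[OF E] hom_sum_eq_edge_form[OF H fin])
  also have "\<dots> = ?r ^ size E"
    unfolding power_mult[symmetric] by (simp only: mult.commute)
  finally have "?l ^ size E = ?r ^ size E" .
  then show ?thesis
    using E by (simp add: power_eq_iff_eq_base norm_H_nonneg nonempty_has_size)
qed

section \<open>The triangle inequality implies the Hoelder inequality\<close>

text \<open>The closure properties of the set of admissible values that the tensor power argument uses: sums
and products of weights, and scaling by nonnegative constants.\<close>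
definition nonneg_semiring :: "real set \<Rightarrow> bool" where
  "nonneg_semiring C \<longleftrightarrow> {0..} \<subseteq> C \<and> (\<forall>a\<in>C. \<forall>b\<in>C. a + b \<in> C \<and> a * b \<in> C)"

lemma nonneg_semiring_sum:
  assumes "nonneg_semiring C" "finite A" "\<And>i. i \<in> A \<Longrightarrow> f i \<in> C"
  shows "sum f A \<in> C"
  using assms(2,3)
proof (induction A rule: finite_induct)
  case empty
  then show ?case using assms(1) by (auto simp: nonneg_semiring_def)
next
  case (insert i A)
  then show ?case using assms(1) by (simp add: nonneg_semiring_def)
qed

lemma triangle_on_sum:
  assumes E: "E \<noteq> {#}" and C: "nonneg_semiring C" and tri: "triangle_on C X Y E I J"
    and "finite A" and "\<And>i p. i \<in> A \<Longrightarrow> f i p \<in> C"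
  shows "norm_H X Y E I J (\<lambda>p. \<Sum>i\<in>A. f i p) \<le> (\<Sum>i\<in>A. norm_H X Y E I J (f i))"
  using assms(4,5)
proof (induction A rule: finite_induct)
  case empty
  then show ?case by (simp add: norm_H_zero[OF E])
next
  case (insert i A)
  have "norm_H X Y E I J (\<lambda>p. f i p + (\<Sum>i\<in>A. f i p))
      \<le> norm_H X Y E I J (f i) + norm_H X Y E I J (\<lambda>p. \<Sum>i\<in>A. f i p)"
    using insert.prems nonneg_semiring_sum[OF C insert.hyps(1)]
    by (intro tri[unfolded triangle_on_def, rule_format]) auto
  moreover have "norm_H X Y E I J (\<lambda>p. \<Sum>i\<in>A. f i p) \<le> (\<Sum>i\<in>A. norm_H X Y E I J (f i))"
    using insert.prems by (intro insert.IH) auto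
  ultimately show ?case using insert.hyps by simp
qed

text \<open>The tensor power trick. For \<open>k = 0\<close>, the value \<open>F(w)\<^sup>2\<close> is one of the terms in the expansion of
\<open>h(\<Sum>\<^sub>e w\<^sub>e \<otimes> w\<^sub>e)\<close>, all of which are squares; the induction step replaces \<open>w\<^sub>e\<close> by its tensor square.
That the right-hand side is independent of \<open>k\<close> is what makes the bound useful.\<close>
lemma edge_form_power_bound:
  fixes I J :: "nat set"
  assumes H: "bipartite_graph X Y E" and E: "E \<noteq> {#}" and C: "nonneg_semiring C"
    and tri: "\<And>(I :: nat set) (J :: nat set). finite I \<Longrightarrow> finite J \<Longrightarrow> triangle_on C X Y E I J"
    and "finite I" "finite J" "\<And>e p. e \<in> edge_copies E \<Longrightarrow> w e p \<in> C"
    and "\<And>e. e \<in> edge_copies E \<Longrightarrow> norm_H X Y E I J (w e) \<le> 1"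
  shows "edge_form X Y E I J w ^ (2 ^ Suc k) \<le> real (size E) ^ size E"
  using assms(5-)
proof (induction k arbitrary: I J w)
  case 0
  note fin = \<open>finite I\<close> \<open>finite J\<close>
  let ?M = "edge_copies E"
  let ?I = "prod_encode ` (I \<times> I)" and ?J = "prod_encode ` (J \<times> J)"
  let ?s = "\<lambda>p. \<Sum>e\<in>?M. tensor_square (w e) p"
  have fin2: "finite ?I" "finite ?J" using fin by auto
  have inC: "tensor_square (w e) p \<in> C" if "e \<in> ?M" for e p
    using "0.prems"(3)[OF that] C
    by (cases p) (auto simp: tensor_square_def nonneg_semiring_def)
  define F where "F c = edge_form X Y E ?I ?J (\<lambda>e. tensor_square (w (c e)))" for c
  have F_sq: "F c = (edge_form X Y E I J (\<lambda>e. w (c e)))\<^sup>2" for c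
    unfolding F_def by (rule edge_form_tensor_square[OF H])
  \<comment> \<open>The term of the identity map is kept, and all other squares are added.\<close>
  have "edge_form X Y E I J w ^ (2 ^ Suc 0) = F (restrict id ?M)"
  proof -
    have "edge_term E (\<lambda>e. w (restrict id ?M e)) = edge_term E w"
      by (rule edge_term_cong) simp
    then show ?thesis by (simp only: F_sq edge_form_def) simp
  qed
  also have "\<dots> \<le> (\<Sum>c\<in>?M \<rightarrow>\<^sub>E ?M. F c)"
    by (rule member_le_sum) (auto simp: F_sq intro: finite_PiE)
  also have "\<dots> = edge_form X Y E ?I ?J (\<lambda>_. ?s)"
    unfolding F_def edge_form_def
    by (subst sum.swap) (simp add: edge_term_sum[of ?M E "\<lambda>i e. tensor_square (w i)"])
  also have "\<dots> \<le> norm_H X Y E ?I ?J ?s ^ size E"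
    by (simp add: norm_H_power[OF E] hom_sum_eq_edge_form[OF H fin2])
  also have "\<dots> \<le> (\<Sum>e\<in>?M. norm_H X Y E ?I ?J (tensor_square (w e))) ^ size E"
    using triangle_on_sum[OF E C tri[OF fin2], of ?M "\<lambda>e. tensor_square (w e)"] inC
    by (intro power_mono norm_H_nonneg) auto
  also have "\<dots> = (\<Sum>e\<in>?M. (norm_H X Y E I J (w e))\<^sup>2) ^ size E"
    by (simp add: norm_H_tensor_square[OF H E fin])
  also have "\<dots> \<le> (\<Sum>e\<in>?M. 1) ^ size E"
    using "0.prems"(4) by (intro power_mono sum_mono sum_nonneg) (auto simp: power_le_one norm_H_nonneg)
  finally show ?case by (simp add: card_edge_copies)
next
  case (Suc k)
  note fin = \<open>finite I\<close> \<open>finite J\<close>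
  let ?I = "prod_encode ` (I \<times> I)" and ?J = "prod_encode ` (J \<times> J)"
  have "edge_form X Y E I J w ^ (2 ^ Suc (Suc k))
      = edge_form X Y E ?I ?J (\<lambda>e. tensor_square (w e)) ^ (2 ^ Suc k)"
    by (simp only: edge_form_tensor_square[OF H] power_Suc[of 2] power_mult)
  also have "\<dots> \<le> real (size E) ^ size E"
  proof (rule Suc.IH)
    show "tensor_square (w e) p \<in> C" if "e \<in> edge_copies E" for e p
      using Suc.prems(3)[OF that] C
      by (cases p) (auto simp: tensor_square_def nonneg_semiring_def)
    show "norm_H X Y E ?I ?J (tensor_square (w e)) \<le> 1" if "e \<in> edge_copies E" for e
      using Suc.prems(4)[OF that]
      by (simp add: norm_H_tensor_square[OF H E fin] power_le_one norm_H_nonneg)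
  qed (use fin in auto)
  finally show ?case .
qed

lemma edge_form_le_1:
  fixes I J :: "nat set"
  assumes "bipartite_graph X Y E" "E \<noteq> {#}" "nonneg_semiring C"
    and "\<And>(I :: nat set) (J :: nat set). finite I \<Longrightarrow> finite J \<Longrightarrow> triangle_on C X Y E I J"
    and "finite I" "finite J" "\<And>e p. e \<in> edge_copies E \<Longrightarrow> w e p \<in> C"
    and "\<And>e. e \<in> edge_copies E \<Longrightarrow> norm_H X Y E I J (w e) \<le> 1"
  shows "edge_form X Y E I J w \<le> 1"
proof (rule ccontr)
  let ?x = "edge_form X Y E I J w"
  assume "\<not> ?x \<le> 1"
  then have x: "1 < ?x" by simp
  obtain n where n: "real (size E) ^ size E < ?x ^ n"
    using real_arch_pow[OF x] by blast
  have "n \<le> 2 ^ Suc n"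
    using less_exp[of "Suc n"] by linarith
  then have "?x ^ n \<le> ?x ^ (2 ^ Suc n)"
    using x by (intro power_increasing) auto
  moreover have "?x ^ (2 ^ Suc n) \<le> real (size E) ^ size E"
    by (rule edge_form_power_bound[OF assms])
  ultimately show False
    using n by linarith
qed

lemma edge_form_scale:
  "edge_form X Y E I J (\<lambda>e p. c e * w e p)
     = (\<Prod>e\<in>edge_copies E. c e) * edge_form X Y E I J w"
  by (simp add: edge_form_def edge_term_eq prod.distrib sum_distrib_left)

text \<open>By homogeneity the weights can be scaled to norm at most \<open>1\<close>.\<close>
lemma triangle_imp_hoelder_on_nat:
  fixes I J :: "nat set"
  assumes H: "bipartite_graph X Y E" and E: "E \<noteq> {#}" and C: "nonneg_semiring C"
    and tri: "\<And>(I :: nat set) (J :: nat set). finite I \<Longrightarrow> finite J \<Longrightarrow> triangle_on C X Y E I J"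
    and fin: "finite I" "finite J"
  shows "hoelder_on C X Y E I J"
  unfolding hoelder_on_def
proof (intro allI impI)
  fix w :: "('a \<times> 'a) \<times> nat \<Rightarrow> nat \<times> nat \<Rightarrow> real"
  let ?M = "edge_copies E" and ?N = "norm_H X Y E I J"
  assume w: "\<forall>e\<in>?M. \<forall>p. w e p \<in> C"
  \<comment> \<open>Some of the norms may vanish, so the scaling uses \<open>\<parallel>w\<^sub>e\<parallel> + \<epsilon>\<close> and lets \<open>\<epsilon>\<close> tend to \<open>0\<close>.\<close>
  have bound: "edge_form X Y E I J w \<le> (\<Prod>e\<in>?M. ?N (w e) + \<epsilon>)" if "\<epsilon> > 0" for \<epsilon>
  proof -
    define d where "d e = ?N (w e) + \<epsilon>" for e
    have d: "d e > 0" "?N (w e) \<le> d e" for e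
      using norm_H_nonneg[of X Y E I J "w e"] that by (auto simp: d_def)
    have "edge_form X Y E I J (\<lambda>e p. inverse (d e) * w e p) \<le> 1"
    proof (rule edge_form_le_1[OF H E C tri fin])
      show "inverse (d e) * w e p \<in> C" if "e \<in> ?M" for e p
      proof -
        have "inverse (d e) \<in> C"
          using C d(1)[of e] unfolding nonneg_semiring_def by (auto simp: less_imp_le)
        then show ?thesis
          using C w that unfolding nonneg_semiring_def by blast
      qed
      show "?N (\<lambda>p. inverse (d e) * w e p) \<le> 1" for e
        using d[of e] unfolding norm_H_scale[OF E] by (simp add: field_simps)
    qed
    then have "(\<Prod>e\<in>?M. inverse (d e)) * edge_form X Y E I J w \<le> 1"
      by (simp only: edge_form_scale)
    moreover have "(\<Prod>e\<in>?M. inverse (d e)) = inverse (\<Prod>e\<in>?M. d e)"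
      using prod_inversef[of d ?M] by (simp add: comp_def)
    moreover have "(\<Prod>e\<in>?M. d e) > 0" using d by (intro prod_pos) auto
    ultimately have "edge_form X Y E I J w \<le> (\<Prod>e\<in>?M. d e)"
      by (simp only:) (simp add: field_simps)
    then show ?thesis by (simp only: d_def)
  qed
  have "((\<lambda>\<epsilon>. \<Prod>e\<in>?M. ?N (w e) + \<epsilon>) \<longlongrightarrow> (\<Prod>e\<in>?M. ?N (w e) + 0)) (at_right 0)"
    by (intro tendsto_intros)
  then have "((\<lambda>\<epsilon>. \<Prod>e\<in>?M. ?N (w e) + \<epsilon>) \<longlongrightarrow> (\<Prod>e\<in>?M. ?N (w e))) (at_right 0)"
    by (simp only: add_0_right)
  moreover have "eventually (\<lambda>\<epsilon>. edge_form X Y E I J w \<le> (\<Prod>e\<in>?M. ?N (w e) + \<epsilon>)) (at_right 0)"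
    using bound by (auto simp: eventually_at_right_field intro: exI[of _ 1])
  ultimately show "edge_form X Y E I J w \<le> (\<Prod>e\<in>?M. ?N (w e))"
    by (rule tendsto_lowerbound) simp
qed

section \<open>Transfer between index types\<close>

text \<open>A finite set injects into any infinite type, and weights are moved along the inverse of the
injection; the values of a weight, hence membership in \<open>C\<close>, are preserved.\<close>
lemma hoelder_on_transfer:
  fixes I :: "'i set" and J :: "'j set"
  assumes H: "bipartite_graph X Y E" and fin: "finite I" "finite J"
    and inf: "\<And>(I' :: 'k::infinite set) (J' :: 'l::infinite set).
           finite I' \<Longrightarrow> finite J' \<Longrightarrow> hoelder_on C X Y E I' J'"
  shows "hoelder_on C X Y E I J"
  unfolding hoelder_on_def
proof (intro allI impI)
  fix w :: "('a \<times> 'a) \<times> nat \<Rightarrow> 'i \<times> 'j \<Rightarrow> real"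
  assume w: "\<forall>e\<in>edge_copies E. \<forall>p. w e p \<in> C"
  obtain f :: "'i \<Rightarrow> 'k" where f: "inj_on f I"
    using arb_inj_on_finite_infinite[OF fin(1)] by blast
  obtain g :: "'j \<Rightarrow> 'l" where g: "inj_on g J"
    using arb_inj_on_finite_infinite[OF fin(2)] by blast
  let ?v = "\<lambda>e p. w e (inv_into I f (fst p), inv_into J g (snd p))"
  have "edge_form X Y E (f ` I) (g ` J) ?v
      \<le> (\<Prod>e\<in>edge_copies E. norm_H X Y E (f ` I) (g ` J) (?v e))"
    using w by (intro inf[unfolded hoelder_on_def, rule_format]) (simp_all add: fin)
  moreover have "edge_form X Y E (f ` I) (g ` J) ?v = edge_form X Y E I J w"
    unfolding edge_form_reindex[OF H f g] unfolding edge_form_def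
    using f g by (intro sum.cong edge_term_weights_cong[OF H]) (auto simp: inv_into_f_f)
  moreover have "norm_H X Y E (f ` I) (g ` J) (?v e) = norm_H X Y E I J (w e)" for e
    unfolding norm_H_reindex[OF H fin f g]
    using f g by (intro norm_H_weights_cong[OF H]) (auto simp: inv_into_f_f)
  ultimately show "edge_form X Y E I J w \<le> (\<Prod>e\<in>edge_copies E. norm_H X Y E I J (w e))"
    by simp
qed

lemma triangle_on_transfer:
  fixes I :: "'i set" and J :: "'j set"
  assumes H: "bipartite_graph X Y E" and fin: "finite I" "finite J"
    and inf: "\<And>(I' :: 'k::infinite set) (J' :: 'l::infinite set).
           finite I' \<Longrightarrow> finite J' \<Longrightarrow> triangle_on C X Y E I' J'"
  shows "triangle_on C X Y E I J"
  unfolding triangle_on_def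
proof (intro allI impI)
  fix u w :: "'i \<times> 'j \<Rightarrow> real"
  assume u: "\<forall>p. u p \<in> C" and w: "\<forall>p. w p \<in> C"
  obtain f :: "'i \<Rightarrow> 'k" where f: "inj_on f I"
    using arb_inj_on_finite_infinite[OF fin(1)] by blast
  obtain g :: "'j \<Rightarrow> 'l" where g: "inj_on g J"
    using arb_inj_on_finite_infinite[OF fin(2)] by blast
  let ?v = "\<lambda>w p. w (inv_into I f (fst p), inv_into J g (snd p))"
  have "norm_H X Y E (f ` I) (g ` J) (\<lambda>p. ?v u p + ?v w p)
      \<le> norm_H X Y E (f ` I) (g ` J) (?v u) + norm_H X Y E (f ` I) (g ` J) (?v w)"
    using u w by (intro inf[unfolded triangle_on_def, rule_format]) (simp_all add: fin)
  moreover have *: "norm_H X Y E (f ` I) (g ` J) (?v h) = norm_H X Y E I J h" for h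
    unfolding norm_H_reindex[OF H fin f g]
    using f g by (intro norm_H_weights_cong[OF H]) (auto simp: inv_into_f_f)
  moreover note *[of "\<lambda>p. u p + w p"]
  ultimately show "norm_H X Y E I J (\<lambda>p. u p + w p) \<le> norm_H X Y E I J u + norm_H X Y E I J w"
    by simp
qed

section \<open>Exhaustion by finite index sets\<close>
lemma vertex_maps_mono: "I \<subseteq> I' \<Longrightarrow> J \<subseteq> J' \<Longrightarrow> vertex_maps X Y I J \<subseteq> vertex_maps X Y I' J'"
  unfolding vertex_maps_def by (intro Sigma_mono PiE_mono) auto

text \<open>Finitely many vertex maps on finitely many vertices use only finitely many indices.\<close>
lemma finite_subset_vertex_maps:
  assumes H: "bipartite_graph X Y E" and F: "finite F" "F \<subseteq> vertex_maps X Y I J"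
  obtains I' J' where "finite I'" "I' \<subseteq> I" "finite J'" "J' \<subseteq> J" "F \<subseteq> vertex_maps X Y I' J'"
proof
  let ?I = "\<Union>z\<in>F. fst z ` X" and ?J = "\<Union>z\<in>F. snd z ` Y"
  show "finite ?I" "finite ?J"
    using H F(1) by (auto simp: bipartite_graph_def)
  show "?I \<subseteq> I" "?J \<subseteq> J"
    using F(2) unfolding vertex_maps_def by (auto dest!: subsetD PiE_mem)
  show "F \<subseteq> vertex_maps X Y ?I ?J"
  proof
    fix z assume z: "z \<in> F"
    then have "z \<in> vertex_maps X Y I J" using F(2) by blast
    moreover have "fst z a \<in> ?I" if "a \<in> X" for a using z that by blast
    moreover have "snd z b \<in> ?J" if "b \<in> Y" for b using z that by blast
    ultimately show "z \<in> vertex_maps X Y ?I ?J"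
      by (simp only: vertex_maps_def mem_Times_iff PiE_iff) simp
  qed
qed

text \<open>The sets of vertex maps into finite index sets are cofinal among all finite sets of vertex maps.
Hence unordered sums over all vertex maps are limits of sums for finite index sets.\<close>
lemma filterlim_vertex_maps:
  assumes H: "bipartite_graph X Y E"
  shows "filterlim (\<lambda>p. vertex_maps X Y (fst p) (snd p))
           (finite_subsets_at_top (vertex_maps X Y I J))
           (finite_subsets_at_top I \<times>\<^sub>F finite_subsets_at_top J)"
  unfolding filterlim_finite_subsets_at_top
proof (intro allI impI, elim conjE)
  fix F assume F: "finite F" "F \<subseteq> vertex_maps X Y I J"
  obtain I' J' where *: "finite I'" "I' \<subseteq> I" "finite J'" "J' \<subseteq> J" "F \<subseteq> vertex_maps X Y I' J'"
    using finite_subset_vertex_maps[OF H F] .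
  show "\<forall>\<^sub>F p in finite_subsets_at_top I \<times>\<^sub>F finite_subsets_at_top J.
      finite (vertex_maps X Y (fst p) (snd p)) \<and> F \<subseteq> vertex_maps X Y (fst p) (snd p) \<and>
      vertex_maps X Y (fst p) (snd p) \<subseteq> vertex_maps X Y I J"
    unfolding eventually_prod_filter
  proof (intro exI conjI allI impI)
    show "\<forall>\<^sub>F A in finite_subsets_at_top I. finite A \<and> I' \<subseteq> A \<and> A \<subseteq> I"
      unfolding eventually_finite_subsets_at_top using * by blast
    show "\<forall>\<^sub>F A in finite_subsets_at_top J. finite A \<and> J' \<subseteq> A \<and> A \<subseteq> J"
      unfolding eventually_finite_subsets_at_top using * by blast
  next
    fix A B assume A: "finite A \<and> I' \<subseteq> A \<and> A \<subseteq> I" and B: "finite B \<and> J' \<subseteq> B \<and> B \<subseteq> J"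
    show "finite (vertex_maps X Y (fst (A, B)) (snd (A, B)))"
      using A B finite_vertex_maps[OF H] by auto
    show "F \<subseteq> vertex_maps X Y (fst (A, B)) (snd (A, B))"
      using A B vertex_maps_mono[of I' A J' B X Y] by (intro order_trans[OF *(5)]) simp
    show "vertex_maps X Y (fst (A, B)) (snd (A, B)) \<subseteq> vertex_maps X Y I J"
      using A B by (simp add: vertex_maps_mono)
  qed
qed

lemma edge_form_tendsto_infsum:
  assumes H: "bipartite_graph X Y E" and "edge_term E w summable_on vertex_maps X Y I J"
  shows "((\<lambda>p. edge_form X Y E (fst p) (snd p) w) \<longlongrightarrow> infsum (edge_term E w) (vertex_maps X Y I J))
           (finite_subsets_at_top I \<times>\<^sub>F finite_subsets_at_top J)"
  unfolding edge_form_def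
  using filterlim_compose[OF infsum_tendsto[OF assms(2)] filterlim_vertex_maps[OF H]] .

lemma eventually_finite_prod:
  "\<forall>\<^sub>F p in finite_subsets_at_top I \<times>\<^sub>F finite_subsets_at_top J. finite (fst p) \<and> finite (snd p)"
  unfolding eventually_prod_filter
  by (intro exI[of _ finite] conjI) (auto simp: eventually_finite_subsets_at_top)

lemma norm_H_tendsto:
  assumes H: "bipartite_graph X Y E" and E: "E \<noteq> {#}"
    and w: "hom_term E w summable_on vertex_maps X Y I J"
  shows "((\<lambda>p. norm_H X Y E (fst p) (snd p) w) \<longlongrightarrow> norm_H X Y E I J w)
           (finite_subsets_at_top I \<times>\<^sub>F finite_subsets_at_top J)"
proof -
  let ?G = "finite_subsets_at_top I \<times>\<^sub>F finite_subsets_at_top J"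
  have "((\<lambda>p. edge_form X Y E (fst p) (snd p) (\<lambda>_. w)) \<longlongrightarrow> hom_sum X Y E I J w) ?G"
    using edge_form_tendsto_infsum[OF H, of "\<lambda>_. w"] w by (simp add: edge_term_const hom_sum_def)
  then have "((\<lambda>p. hom_sum X Y E (fst p) (snd p) w) \<longlongrightarrow> hom_sum X Y E I J w) ?G"
    by (rule Lim_transform_eventually)
      (rule eventually_mono[OF eventually_finite_prod], simp add: hom_sum_eq_edge_form[OF H])
  then show ?thesis
    unfolding norm_H_def using E
    by (intro tendsto_powr' tendsto_rabs tendsto_const) (auto simp: nonempty_has_size)
qed

text \<open>Unordered convergence of real sums is absolute, so the two finiteness conditions coincide.\<close>
lemma W_rH_eq_W_H: "W_rH X Y E I J = W_H X Y E I J"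
  unfolding W_H_def W_rH_def summable_on_iff_abs_summable_on_real[of "hom_term E w" for w]
  by (simp add: hom_term_abs[abs_def])

lemma has_sum_finite_sum:
  fixes f :: "'c \<Rightarrow> 'd \<Rightarrow> 'b :: topological_comm_monoid_add"
  assumes "finite B" "\<And>c. c \<in> B \<Longrightarrow> (f c has_sum s c) A"
  shows "((\<lambda>z. \<Sum>c\<in>B. f c z) has_sum (\<Sum>c\<in>B. s c)) A"
  using assms by (induction B rule: finite_induct) (auto intro: has_sum_add has_sum_0)

lemma norm_rH_eq_norm_H: "norm_rH X Y E I J w = norm_H X Y E I J (\<lambda>p. \<bar>w p\<bar>)"
proof -
  have "0 \<le> hom_sum X Y E I J (\<lambda>p. \<bar>w p\<bar>)"
    unfolding hom_sum_def by (rule infsum_nonneg) (simp add: hom_term_abs)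
  then show ?thesis by (simp add: norm_rH_def norm_H_def)
qed

lemma W_H_summable: "w \<in> W_H X Y E I J \<Longrightarrow> hom_term E w summable_on vertex_maps X Y I J"
  by (simp add: W_H_def)

lemma W_H_abs: "w \<in> W_H X Y E I J \<Longrightarrow> (\<lambda>p. \<bar>w p\<bar>) \<in> W_H X Y E I J"
  unfolding W_rH_eq_W_H[symmetric] by (auto simp: W_rH_def weights_def)

lemma W_H_scale:
  assumes "w \<in> W_H X Y E I J"
  shows "(\<lambda>p. c * w p) \<in> W_H X Y E I J"
  using assms unfolding W_H_def
  by (auto simp: weights_def hom_term_scale intro: summable_on_cmult_right cong: summable_on_cong)

lemma norm_H_abs_mono_sets:
  assumes H: "bipartite_graph X Y E" and w: "w \<in> W_H X Y E I J"
    and fin: "finite I'" "finite J'" and sub: "I' \<subseteq> I" "J' \<subseteq> J"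
  shows "norm_H X Y E I' J' (\<lambda>p. \<bar>w p\<bar>) \<le> norm_H X Y E I J (\<lambda>p. \<bar>w p\<bar>)"
proof -
  let ?h = "hom_term E (\<lambda>p. \<bar>w p\<bar>)"
  have "hom_sum X Y E I' J' (\<lambda>p. \<bar>w p\<bar>) = sum ?h (vertex_maps X Y I' J')"
    using finite_vertex_maps[OF H fin] by (simp add: hom_sum_def)
  also have "\<dots> \<le> hom_sum X Y E I J (\<lambda>p. \<bar>w p\<bar>)"
    unfolding hom_sum_def
    by (intro finite_sum_le_infsum W_H_summable W_H_abs w finite_vertex_maps[OF H fin]
        vertex_maps_mono sub) (simp add: hom_term_abs)
  finally have "hom_sum X Y E I' J' (\<lambda>p. \<bar>w p\<bar>) \<le> hom_sum X Y E I J (\<lambda>p. \<bar>w p\<bar>)" .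
  moreover have "0 \<le> hom_sum X Y E I' J' (\<lambda>p. \<bar>w p\<bar>)"
    unfolding hom_sum_def by (rule infsum_nonneg) (simp add: hom_term_abs)
  ultimately show ?thesis
    unfolding norm_H_def by (intro powr_mono2) auto
qed

text \<open>A finite partial sum of \<open>\<bar>edge_term E w\<bar>\<close> lies within finite index sets. There the Hoelder
inequality for the nonnegative weights \<open>\<bar>w e\<bar>\<close> bounds it by a product of norms that only grow when
the index sets are enlarged to \<open>I\<close> and \<open>J\<close>.\<close>
lemma edge_term_summable:
  fixes I :: "'i set" and J :: "'j set"
  assumes H: "bipartite_graph X Y E"
    and hoel: "\<And>(I' :: 'i set) (J' :: 'j set). finite I' \<Longrightarrow> finite J' \<Longrightarrow> hoelder_on {0..} X Y E I' J'"
    and w: "\<And>e. e \<in> edge_copies E \<Longrightarrow> w e \<in> W_H X Y E I J"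
  shows "edge_term E w summable_on vertex_maps X Y I J"
proof -
  let ?M = "edge_copies E" and ?V = "vertex_maps X Y I J"
  let ?a = "\<lambda>e p. \<bar>w e p\<bar>"
  let ?B = "\<Prod>e\<in>?M. norm_H X Y E I J (?a e)"
  have "sum (\<lambda>z. \<bar>edge_term E w z\<bar>) F \<le> ?B" if F: "F \<subseteq> ?V" "finite F" for F
  proof -
    obtain I' J' where fin: "finite I'" "finite J'" and sub: "I' \<subseteq> I" "J' \<subseteq> J"
      and FV: "F \<subseteq> vertex_maps X Y I' J'"
      using finite_subset_vertex_maps[OF H F(2,1)] by metis
    have "sum (\<lambda>z. \<bar>edge_term E w z\<bar>) F \<le> edge_form X Y E I' J' ?a"
      unfolding edge_form_def edge_term_abs
      by (intro sum_mono2 finite_vertex_maps[OF H fin] FV) simp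
    also have "\<dots> \<le> (\<Prod>e\<in>?M. norm_H X Y E I' J' (?a e))"
      by (rule hoel[OF fin, unfolded hoelder_on_def, rule_format]) simp
    also have "\<dots> \<le> ?B"
      by (intro prod_mono conjI norm_H_nonneg norm_H_abs_mono_sets[OF H w fin sub])
    finally show ?thesis .
  qed
  then have "(\<lambda>z. \<bar>edge_term E w z\<bar>) summable_on ?V"
    by (intro nonneg_bdd_above_summable_on bdd_aboveI2[of _ _ ?B]) auto
  then show ?thesis
    by (simp add: summable_on_iff_abs_summable_on_real[of "edge_term E w"])
qed

text \<open>Both sides of the inequality for finite index sets converge to the two sides for \<open>I\<close> and \<open>J\<close>.\<close>
lemma hoelder_on_imp_hoelder_infsum:
  fixes I :: "'i set" and J :: "'j set"
  assumes H: "bipartite_graph X Y E" and E: "E \<noteq> {#}"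
    and hoel: "\<And>(I' :: 'i set) (J' :: 'j set). finite I' \<Longrightarrow> finite J' \<Longrightarrow> hoelder_on C X Y E I' J'"
    and w: "\<And>e. e \<in> edge_copies E \<Longrightarrow> w e \<in> W_H X Y E I J"
    and wC: "\<And>e p. e \<in> edge_copies E \<Longrightarrow> w e p \<in> C"
    and summ: "edge_term E w summable_on vertex_maps X Y I J"
  shows "infsum (edge_term E w) (vertex_maps X Y I J)
       \<le> (\<Prod>e\<in>edge_copies E. norm_H X Y E I J (w e))"
proof (rule tendsto_le)
  let ?G = "finite_subsets_at_top I \<times>\<^sub>F finite_subsets_at_top J"
  show "?G \<noteq> bot" by (simp add: prod_filter_eq_bot)
  show "((\<lambda>p. \<Prod>e\<in>edge_copies E. norm_H X Y E (fst p) (snd p) (w e))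
      \<longlongrightarrow> (\<Prod>e\<in>edge_copies E. norm_H X Y E I J (w e))) ?G"
    by (intro tendsto_prod norm_H_tendsto[OF H E] W_H_summable w)
  show "((\<lambda>p. edge_form X Y E (fst p) (snd p) w)
      \<longlongrightarrow> infsum (edge_term E w) (vertex_maps X Y I J)) ?G"
    by (rule edge_form_tendsto_infsum[OF H summ])
  show "\<forall>\<^sub>F p in ?G. edge_form X Y E (fst p) (snd p) w
      \<le> (\<Prod>e\<in>edge_copies E. norm_H X Y E (fst p) (snd p) (w e))"
    using eventually_finite_prod
  proof (rule eventually_mono)
    fix p :: "'i set \<times> 'j set"
    assume "finite (fst p) \<and> finite (snd p)"
    then show "edge_form X Y E (fst p) (snd p) w
        \<le> (\<Prod>e\<in>edge_copies E. norm_H X Y E (fst p) (snd p) (w e))"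
      using wC by (intro hoel[unfolded hoelder_on_def, rule_format]) auto
  qed
qed

section \<open>The Hoelder properties reduce to finite sets of natural numbers\<close>
lemma hoelder_summable:
  assumes "hoelder TYPE('i) TYPE('j) X Y E"
    and "\<And>e. e \<in> edge_copies E \<Longrightarrow> w e \<in> W_H X Y E (I :: 'i set) (J :: 'j set)"
  shows "edge_term E w summable_on vertex_maps X Y I J"
  using assms unfolding hoelder_def by simp

lemma hoelder_inequality:
  assumes "hoelder TYPE('i) TYPE('j) X Y E"
    and "\<And>e. e \<in> edge_copies E \<Longrightarrow> w e \<in> W_H X Y E (I :: 'i set) (J :: 'j set)"
  shows "infsum (edge_term E w) (vertex_maps X Y I J)
       \<le> (\<Prod>e\<in>edge_copies E. norm_H X Y E I J (w e))"
  using assms unfolding hoelder_def by simp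

lemma weakly_hoelder_summable:
  assumes "weakly_hoelder TYPE('i) TYPE('j) X Y E"
    and "\<And>e. e \<in> edge_copies E \<Longrightarrow> w e \<in> W_rH X Y E (I :: 'i set) (J :: 'j set)"
  shows "edge_term E w summable_on vertex_maps X Y I J"
  using assms unfolding weakly_hoelder_def by simp

lemma weakly_hoelder_inequality:
  assumes "weakly_hoelder TYPE('i) TYPE('j) X Y E"
    and "\<And>e. e \<in> edge_copies E \<Longrightarrow> w e \<in> W_rH X Y E (I :: 'i set) (J :: 'j set)"
  shows "infsum (edge_term E w) (vertex_maps X Y I J)
       \<le> (\<Prod>e\<in>edge_copies E. norm_rH X Y E I J (w e))"
  using assms unfolding weakly_hoelder_def by simp

text \<open>Weights that are arbitrary outside \<open>I \<times> J\<close> become members of \<^const>\<open>weights\<close>.\<close>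
definition zero_ext :: "'i set \<Rightarrow> 'j set \<Rightarrow> ('i \<times> 'j \<Rightarrow> real) \<Rightarrow> 'i \<times> 'j \<Rightarrow> real" where
  "zero_ext I J w = (\<lambda>p. if p \<in> I \<times> J then w p else 0)"

lemma zero_ext_in_W_H:
  assumes "bipartite_graph X Y E" "finite I" "finite J"
  shows "zero_ext I J w \<in> W_H X Y E I J"
  using finite_vertex_maps[OF assms] by (auto simp: W_H_def weights_def zero_ext_def)

lemma norm_H_zero_ext:
  assumes "bipartite_graph X Y E"
  shows "norm_H X Y E I J (zero_ext I J w) = norm_H X Y E I J w"
  by (rule norm_H_weights_cong[OF assms]) (simp add: zero_ext_def)

lemma infsum_edge_term_zero_ext:
  assumes H: "bipartite_graph X Y E" and "finite I" "finite J"
  shows "infsum (edge_term E (\<lambda>e. zero_ext I J (w e))) (vertex_maps X Y I J)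
       = edge_form X Y E I J w"
proof -
  have "infsum (edge_term E (\<lambda>e. zero_ext I J (w e))) (vertex_maps X Y I J)
      = edge_form X Y E I J (\<lambda>e. zero_ext I J (w e))"
    using finite_vertex_maps[OF assms] by (simp add: edge_form_def)
  also have "\<dots> = edge_form X Y E I J w"
    unfolding edge_form_def
    by (intro sum.cong refl edge_term_weights_cong[OF H]) (auto simp: zero_ext_def)
  finally show ?thesis .
qed

text \<open>The right-hand side does not mention the index types, so the Hoelder property is
the same for all pairs of infinite index types.\<close>
lemma hoelder_iff_finite:
  assumes H: "bipartite_graph X Y E" and E: "E \<noteq> {#}"
  shows "hoelder TYPE('i::infinite) TYPE('j::infinite) X Y E \<longleftrightarrow>
           (\<forall>(I :: nat set) (J :: nat set). finite I \<longrightarrow> finite J \<longrightarrow> hoelder_on UNIV X Y E I J)"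
proof
  assume hoel: "hoelder TYPE('i) TYPE('j) X Y E"
  have "hoelder_on UNIV X Y E I J" if fin: "finite I" "finite J" for I :: "'i set" and J :: "'j set"
    unfolding hoelder_on_def
  proof (intro allI impI)
    fix w :: "('a \<times> 'a) \<times> nat \<Rightarrow> 'i \<times> 'j \<Rightarrow> real"
    have "infsum (edge_term E (\<lambda>e. zero_ext I J (w e))) (vertex_maps X Y I J)
        \<le> (\<Prod>e\<in>edge_copies E. norm_H X Y E I J (zero_ext I J (w e)))"
      by (intro hoelder_inequality[OF hoel] zero_ext_in_W_H[OF H fin])
    then show "edge_form X Y E I J w \<le> (\<Prod>e\<in>edge_copies E. norm_H X Y E I J (w e))"
      by (simp only: infsum_edge_term_zero_ext[OF H fin] norm_H_zero_ext[OF H])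
  qed
  then show "\<forall>(I :: nat set) (J :: nat set).
      finite I \<longrightarrow> finite J \<longrightarrow> hoelder_on UNIV X Y E I J"
    using hoelder_on_transfer[OF H] by blast
next
  assume nat: "\<forall>(I :: nat set) (J :: nat set).
      finite I \<longrightarrow> finite J \<longrightarrow> hoelder_on UNIV X Y E I J"
  have hoel: "hoelder_on UNIV X Y E I J" if "finite I" "finite J" for I :: "'i set" and J :: "'j set"
    by (rule hoelder_on_transfer[OF H that]) (use nat in blast)
  \<comment> \<open>Convergence only involves the absolute values of the weights.\<close>
  then have hoel0: "hoelder_on {0..} X Y E I J" if "finite I" "finite J"
    for I :: "'i set" and J :: "'j set"
    using that unfolding hoelder_on_def by simp
  show "hoelder TYPE('i) TYPE('j) X Y E"
    unfolding hoelder_def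
  proof (intro allI impI)
    fix I :: "'i set" and J :: "'j set" and w :: "('a \<times> 'a) \<times> nat \<Rightarrow> 'i \<times> 'j \<Rightarrow> real"
    assume w: "\<forall>e\<in>edge_copies E. w e \<in> W_H X Y E I J"
    have summ: "edge_term E w summable_on vertex_maps X Y I J"
      using w by (intro edge_term_summable[OF H hoel0]) auto
    moreover have "infsum (edge_term E w) (vertex_maps X Y I J)
        \<le> (\<Prod>e\<in>edge_copies E. norm_H X Y E I J (w e))"
      using w by (intro hoelder_on_imp_hoelder_infsum[OF H E hoel _ _ summ]) auto
    ultimately show "edge_term E w summable_on vertex_maps X Y I J \<and>
        infsum (edge_term E w) (vertex_maps X Y I J)
          \<le> (\<Prod>e\<in>edge_copies E. norm_H X Y E I J (w e))" ..
  qed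
qed

text \<open>Only nonnegative weights matter here, because replacing all weights by their absolute values
increases the left-hand side and does not affect the right-hand side.\<close>
lemma weakly_hoelder_iff_finite:
  assumes H: "bipartite_graph X Y E" and E: "E \<noteq> {#}"
  shows "weakly_hoelder TYPE('i::infinite) TYPE('j::infinite) X Y E \<longleftrightarrow>
           (\<forall>(I :: nat set) (J :: nat set). finite I \<longrightarrow> finite J \<longrightarrow> hoelder_on {0..} X Y E I J)"
proof
  assume hoel: "weakly_hoelder TYPE('i) TYPE('j) X Y E"
  have "hoelder_on {0..} X Y E I J" if fin: "finite I" "finite J" for I :: "'i set" and J :: "'j set"
    unfolding hoelder_on_def
  proof (intro allI impI)
    fix w :: "('a \<times> 'a) \<times> nat \<Rightarrow> 'i \<times> 'j \<Rightarrow> real"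
    assume w: "\<forall>e\<in>edge_copies E. \<forall>p. w e p \<in> {0..}"
    have norm_eq: "norm_rH X Y E I J (zero_ext I J (w e)) = norm_H X Y E I J (w e)"
      if "e \<in> edge_copies E" for e
    proof -
      have "(\<lambda>p. \<bar>zero_ext I J (w e) p\<bar>) = zero_ext I J (w e)"
        using w that by (auto simp: zero_ext_def)
      then show ?thesis by (simp add: norm_rH_eq_norm_H norm_H_zero_ext[OF H])
    qed
    have "infsum (edge_term E (\<lambda>e. zero_ext I J (w e))) (vertex_maps X Y I J)
        \<le> (\<Prod>e\<in>edge_copies E. norm_rH X Y E I J (zero_ext I J (w e)))"
      by (intro weakly_hoelder_inequality[OF hoel]) (simp add: W_rH_eq_W_H zero_ext_in_W_H[OF H fin])
    then show "edge_form X Y E I J w \<le> (\<Prod>e\<in>edge_copies E. norm_H X Y E I J (w e))"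
      by (simp add: infsum_edge_term_zero_ext[OF H fin] norm_eq)
  qed
  then show "\<forall>(I :: nat set) (J :: nat set).
      finite I \<longrightarrow> finite J \<longrightarrow> hoelder_on {0..} X Y E I J"
    using hoelder_on_transfer[OF H] by blast
next
  assume nat: "\<forall>(I :: nat set) (J :: nat set).
      finite I \<longrightarrow> finite J \<longrightarrow> hoelder_on {0..} X Y E I J"
  have hoel: "hoelder_on {0..} X Y E I J" if "finite I" "finite J" for I :: "'i set" and J :: "'j set"
    by (rule hoelder_on_transfer[OF H that]) (use nat in blast)
  show "weakly_hoelder TYPE('i) TYPE('j) X Y E"
    unfolding weakly_hoelder_def W_rH_eq_W_H
  proof (intro allI impI)
    fix I :: "'i set" and J :: "'j set" and w :: "('a \<times> 'a) \<times> nat \<Rightarrow> 'i \<times> 'j \<Rightarrow> real"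
    assume w: "\<forall>e\<in>edge_copies E. w e \<in> W_H X Y E I J"
    let ?a = "\<lambda>e p. \<bar>w e p\<bar>"
    have summ: "edge_term E w summable_on vertex_maps X Y I J"
      using w by (intro edge_term_summable[OF H hoel]) auto
    have summ_abs: "edge_term E ?a summable_on vertex_maps X Y I J"
      using w by (intro edge_term_summable[OF H hoel] W_H_abs) auto
    have "infsum (edge_term E w) (vertex_maps X Y I J)
        \<le> infsum (edge_term E ?a) (vertex_maps X Y I J)"
      by (rule infsum_mono[OF summ summ_abs]) (simp add: edge_term_abs)
    also have "\<dots> \<le> (\<Prod>e\<in>edge_copies E. norm_H X Y E I J (?a e))"
      using w by (intro hoelder_on_imp_hoelder_infsum[OF H E hoel _ _ summ_abs] W_H_abs) auto
    finally show "edge_term E w summable_on vertex_maps X Y I J \<and>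
        infsum (edge_term E w) (vertex_maps X Y I J)
          \<le> (\<Prod>e\<in>edge_copies E. norm_rH X Y E I J (w e))"
      using summ by (simp add: norm_rH_eq_norm_H)
  qed
qed

section \<open>The Hoelder inequality implies the triangle inequality\<close>

text \<open>Here \<open>a\<close> and \<open>b\<close> stand for the norms of \<open>u\<close> and \<open>w\<close>. The choice \<open>c\<close> tells which edges carry \<open>u\<close>;
summing the bounds over all choices gives the product \<open>(a + b) ^ size E\<close>. The hypotheses ask for the
Hoelder inequality only at families made of \<open>u\<close> and \<open>w\<close>, so that the Hoelder and the
weakly Hoelder case can share the argument.\<close>
lemma hom_term_add_bound:
  assumes E: "E \<noteq> {#}" and ab: "0 \<le> a" "0 \<le> b"
    and summ: "\<And>c. edge_term E (\<lambda>e. if c e then u else w) summable_on vertex_maps X Y I J"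
    and bound: "\<And>c. \<bar>infsum (edge_term E (\<lambda>e. if c e then u else w)) (vertex_maps X Y I J)\<bar>
                   \<le> (\<Prod>e\<in>edge_copies E. if c e then a else b)"
  shows "hom_term E (\<lambda>p. u p + w p) summable_on vertex_maps X Y I J"
    and "norm_H X Y E I J (\<lambda>p. u p + w p) \<le> a + b"
proof -
  let ?V = "vertex_maps X Y I J" and ?M = "edge_copies E"
  let ?P = "?M \<rightarrow>\<^sub>E (UNIV :: bool set)"
  let ?t = "\<lambda>c. edge_term E (\<lambda>e. if c e then u else w)"
  have expand: "hom_term E (\<lambda>p. u p + w p) = (\<lambda>z. \<Sum>c\<in>?P. ?t c z)"
  proof
    fix z
    have "hom_term E (\<lambda>p. u p + w p) z
        = edge_term E (\<lambda>e p. \<Sum>c\<in>UNIV. (if c then u else w) p) z"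
      by (simp add: UNIV_bool add.commute flip: edge_term_const)
    also have "\<dots> = (\<Sum>c\<in>?P. ?t c z)"
      using edge_term_sum[of "UNIV :: bool set" E "\<lambda>c e. if c then u else w" z] by simp
    finally show "hom_term E (\<lambda>p. u p + w p) z = (\<Sum>c\<in>?P. ?t c z)" .
  qed
  have has_sum_sum: "((\<lambda>z. \<Sum>c\<in>?P. ?t c z) has_sum (\<Sum>c\<in>?P. infsum (?t c) ?V)) ?V"
    by (intro has_sum_finite_sum finite_PiE has_sum_infsum summ) simp_all
  show "hom_term E (\<lambda>p. u p + w p) summable_on ?V"
    unfolding expand using has_sum_sum by (rule has_sum_imp_summable)
  have "\<bar>hom_sum X Y E I J (\<lambda>p. u p + w p)\<bar> = \<bar>\<Sum>c\<in>?P. infsum (?t c) ?V\<bar>"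
    unfolding hom_sum_def expand by (simp only: infsumI[OF has_sum_sum])
  also have "\<dots> \<le> (\<Sum>c\<in>?P. \<Prod>e\<in>?M. if c e then a else b)"
    using bound by (intro sum_abs[THEN order_trans] sum_mono)
  also have "\<dots> = (\<Prod>e\<in>?M. \<Sum>c\<in>UNIV. if c then a else b)"
    by (rule prod_sum_PiE[symmetric]) simp_all
  also have "\<dots> = (a + b) ^ size E"
    by (simp add: UNIV_bool card_edge_copies add.commute)
  finally show "norm_H X Y E I J (\<lambda>p. u p + w p) \<le> a + b"
    using ab by (simp add: norm_H_le_iff[OF E])
qed

text \<open>Negating the weight of a single edge negates the left-hand side of the Hoelder inequality and keeps
all norms.\<close>
lemma hoelder_abs_bound:
  assumes E: "E \<noteq> {#}" and hoel: "hoelder TYPE('i) TYPE('j) X Y E"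
    and w: "\<And>e. e \<in> edge_copies E \<Longrightarrow> w e \<in> W_H X Y E (I :: 'i set) (J :: 'j set)"
  shows "\<bar>infsum (edge_term E w) (vertex_maps X Y I J)\<bar>
       \<le> (\<Prod>e\<in>edge_copies E. norm_H X Y E I J (w e))"
proof -
  let ?M = "edge_copies E" and ?V = "vertex_maps X Y I J"
  obtain e0 where e0: "e0 \<in> ?M" using edge_copies_nonempty[OF E] by blast
  define s :: "('a \<times> 'a) \<times> nat \<Rightarrow> real" where "s e = (if e = e0 then -1 else 1)" for e
  have "edge_term E (\<lambda>e p. s e * w e p) = (\<lambda>z. - edge_term E w z)"
    using e0 by (auto simp: edge_term_eq prod.distrib s_def prod.delta)
  moreover have "infsum (edge_term E (\<lambda>e p. s e * w e p)) ?V
      \<le> (\<Prod>e\<in>?M. norm_H X Y E I J (\<lambda>p. s e * w e p))"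
    by (intro hoelder_inequality[OF hoel] W_H_scale w)
  moreover have "(\<Prod>e\<in>?M. norm_H X Y E I J (\<lambda>p. s e * w e p)) = (\<Prod>e\<in>?M. norm_H X Y E I J (w e))"
    by (rule prod.cong) (auto simp: norm_H_scale[OF E] s_def)
  ultimately have "- infsum (edge_term E w) ?V \<le> (\<Prod>e\<in>?M. norm_H X Y E I J (w e))"
    by (simp add: infsum_uminus)
  moreover have "infsum (edge_term E w) ?V \<le> (\<Prod>e\<in>?M. norm_H X Y E I J (w e))"
    by (intro hoelder_inequality[OF hoel] w)
  ultimately show ?thesis by simp
qed

lemma zero_in_W_H:
  assumes "E \<noteq> {#}"
  shows "(\<lambda>_. 0) \<in> W_H X Y E (I :: 'i set) (J :: 'j set)"
proof -
  have "hom_term E (\<lambda>_ :: 'i \<times> 'j. 0) = (\<lambda>_. 0)"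
  proof
    fix z
    show "hom_term E (\<lambda>_. 0) z = 0"
      using hom_term_scale[of E 0 "\<lambda>_. 0" z] assms by (simp add: zero_power nonempty_has_size)
  qed
  then show ?thesis by (simp add: W_H_def weights_def)
qed

lemma hoelder_imp_seminorm:
  assumes E: "E \<noteq> {#}" and hoel: "hoelder TYPE('i) TYPE('j) X Y E"
  shows "seminorm_on (W_H X Y E I J) (norm_H X Y E (I :: 'i set) (J :: 'j set))"
proof -
  let ?W = "W_H X Y E I J" and ?N = "norm_H X Y E I J"
  have add: "(\<lambda>p. u p + w p) \<in> ?W \<and> ?N (\<lambda>p. u p + w p) \<le> ?N u + ?N w"
    if u: "u \<in> ?W" and w: "w \<in> ?W" for u w
  proof -
    have choice: "(if c e then u else w) \<in> ?W" for c :: "('a \<times> 'a) \<times> nat \<Rightarrow> bool" and e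
      using u w by simp
    have summ: "edge_term E (\<lambda>e. if c e then u else w) summable_on vertex_maps X Y I J" for c
      by (intro hoelder_summable[OF hoel] choice)
    have bound: "\<bar>infsum (edge_term E (\<lambda>e. if c e then u else w)) (vertex_maps X Y I J)\<bar>
        \<le> (\<Prod>e\<in>edge_copies E. if c e then ?N u else ?N w)" for c
      using hoelder_abs_bound[OF E hoel choice]
      by (rule order_trans) (simp add: if_distrib[of "norm_H X Y E I J"])
    show ?thesis
      using hom_term_add_bound[OF E norm_H_nonneg norm_H_nonneg summ bound] u w
      by (simp add: W_H_def weights_def)
  qed
  show ?thesis
    unfolding seminorm_on_def function_subspace_def
    using add by (simp add: zero_in_W_H[OF E] W_H_scale norm_H_nonneg norm_H_scale[OF E])
qed

text \<open>The vertex map that sends \<open>X\<close> to \<open>i\<close> and \<open>Y\<close> to \<open>j\<close> contributes \<open>\<bar>w (i, j)\<bar> ^ size E\<close> to a sum of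
nonnegative terms.\<close>
lemma norm_rH_definite:
  assumes H: "bipartite_graph X Y E" and E: "E \<noteq> {#}"
    and w: "w \<in> W_rH X Y E I J" and zero: "norm_rH X Y E I J w = 0"
  shows "w = (\<lambda>_. 0)"
proof
  fix p
  show "w p = 0"
  proof (cases "p \<in> I \<times> J")
    case False
    then show ?thesis using w unfolding W_rH_def weights_def by blast
  next
    case True
    define z where "z = ((\<lambda>a\<in>X. fst p), (\<lambda>b\<in>Y. snd p))"
    have z: "z \<in> vertex_maps X Y I J"
      using True by (auto simp: vertex_maps_def z_def)
    have "hom_term E (\<lambda>p. \<bar>w p\<bar>) z = (\<Prod>e\<in>edge_copies E. \<bar>w p\<bar>)"
      unfolding edge_term_const[symmetric] edge_term_eq
      using edge_ends[OF H] by (intro prod.cong) (auto simp: z_def)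
    then have "\<bar>w p\<bar> ^ size E = sum (hom_term E (\<lambda>p. \<bar>w p\<bar>)) {z}"
      by (simp add: card_edge_copies)
    also have "\<dots> \<le> hom_sum X Y E I J (\<lambda>p. \<bar>w p\<bar>)"
      unfolding hom_sum_def using w z
      by (intro finite_sum_le_infsum) (auto simp: W_rH_def hom_term_abs)
    also have "\<dots> \<le> norm_rH X Y E I J w ^ size E"
      by (simp add: norm_rH_eq_norm_H norm_H_power[OF E])
    finally have "\<bar>w p\<bar> ^ size E \<le> 0"
      using zero E by (simp add: zero_power nonempty_has_size)
    then have "\<bar>w p\<bar> ^ size E = 0"
      by (intro antisym) simp_all
    then show ?thesis by simp
  qed
qed

text \<open>As \<open>\<bar>u + w\<bar> \<le> \<bar>u\<bar> + \<bar>w\<bar>\<close> pointwise, it suffices to expand \<open>h(\<bar>u\<bar> + \<bar>w\<bar>)\<close>, where every weight is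
nonnegative.\<close>
lemma weakly_hoelder_imp_norm:
  assumes H: "bipartite_graph X Y E" and E: "E \<noteq> {#}"
    and hoel: "weakly_hoelder TYPE('i) TYPE('j) X Y E"
  shows "norm_on (W_rH X Y E I J) (norm_rH X Y E (I :: 'i set) (J :: 'j set))"
proof -
  let ?W = "W_H X Y E I J" and ?N = "norm_H X Y E I J" and ?V = "vertex_maps X Y I J"
  let ?Nr = "norm_rH X Y E I J"
  have add: "(\<lambda>p. u p + w p) \<in> ?W \<and> ?Nr (\<lambda>p. u p + w p) \<le> ?Nr u + ?Nr w"
    if u: "u \<in> ?W" and w: "w \<in> ?W" for u w
  proof -
    let ?u = "\<lambda>p. \<bar>u p\<bar>" and ?w = "\<lambda>p. \<bar>w p\<bar>"
    have choice: "(if c e then ?u else ?w) \<in> W_rH X Y E I J" for c :: "('a \<times> 'a) \<times> nat \<Rightarrow> bool" and e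
      using W_H_abs[OF u] W_H_abs[OF w] by (simp add: W_rH_eq_W_H)
    have summ: "edge_term E (\<lambda>e. if c e then ?u else ?w) summable_on ?V" for c
      by (intro weakly_hoelder_summable[OF hoel] choice)
    have bound: "\<bar>infsum (edge_term E (\<lambda>e. if c e then ?u else ?w)) ?V\<bar>
        \<le> (\<Prod>e\<in>edge_copies E. if c e then ?N ?u else ?N ?w)" for c
    proof -
      have "infsum (edge_term E (\<lambda>e. if c e then ?u else ?w)) ?V
          \<le> (\<Prod>e\<in>edge_copies E. norm_rH X Y E I J (if c e then ?u else ?w))"
        by (intro weakly_hoelder_inequality[OF hoel] choice)
      also have "\<dots> = (\<Prod>e\<in>edge_copies E. if c e then ?N ?u else ?N ?w)"
        by (rule prod.cong) (auto simp: norm_rH_eq_norm_H)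
      finally have "infsum (edge_term E (\<lambda>e. if c e then ?u else ?w)) ?V
          \<le> (\<Prod>e\<in>edge_copies E. if c e then ?N ?u else ?N ?w)" .
      moreover have "0 \<le> infsum (edge_term E (\<lambda>e. if c e then ?u else ?w)) ?V"
        by (intro infsum_nonneg) (auto simp: edge_term_eq intro!: prod_nonneg)
      ultimately show ?thesis by simp
    qed
    note sum_bound = hom_term_add_bound[OF E norm_H_nonneg norm_H_nonneg summ bound]
    have le: "hom_term E (\<lambda>p. \<bar>u p + w p\<bar>) z \<le> hom_term E (\<lambda>p. \<bar>u p\<bar> + \<bar>w p\<bar>) z" for z
      unfolding edge_term_const[symmetric] edge_term_eq by (intro prod_mono) auto
    have nonneg: "0 \<le> hom_term E (\<lambda>p. \<bar>u p + w p\<bar>) z" for z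
      by (simp add: hom_term_abs)
    have summ_abs: "hom_term E (\<lambda>p. \<bar>u p + w p\<bar>) summable_on ?V"
      using sum_bound(1) by (rule summable_on_comparison_test) (auto simp: le nonneg)
    then have "(\<lambda>p. u p + w p) \<in> ?W"
      using u w unfolding W_rH_eq_W_H[symmetric] by (simp add: W_rH_def weights_def)
    moreover have "?N (\<lambda>p. \<bar>u p + w p\<bar>) \<le> ?N (\<lambda>p. \<bar>u p\<bar> + \<bar>w p\<bar>)"
    proof -
      have "0 \<le> hom_sum X Y E I J (\<lambda>p. \<bar>u p + w p\<bar>)"
        unfolding hom_sum_def by (rule infsum_nonneg) (rule nonneg)
      moreover have "hom_sum X Y E I J (\<lambda>p. \<bar>u p + w p\<bar>) \<le> hom_sum X Y E I J (\<lambda>p. \<bar>u p\<bar> + \<bar>w p\<bar>)"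
        unfolding hom_sum_def by (rule infsum_mono[OF summ_abs sum_bound(1) le])
      ultimately show ?thesis
        unfolding norm_H_def by (intro powr_mono2) auto
    qed
    ultimately show ?thesis
      using sum_bound(2) by (simp add: norm_rH_eq_norm_H)
  qed
  have scale: "?Nr (\<lambda>p. c * w p) = \<bar>c\<bar> * ?Nr w" for c w
    by (simp add: norm_rH_eq_norm_H abs_mult norm_H_scale[OF E])
  have "seminorm_on ?W ?Nr"
    unfolding seminorm_on_def function_subspace_def
    using add by (simp add: zero_in_W_H[OF E] W_H_scale scale) (simp add: norm_rH_def)
  then show ?thesis
    unfolding norm_on_def using norm_rH_definite[OF H E]
    by (auto simp: W_rH_eq_W_H)
qed

section \<open>The equivalences\<close>
lemma seminorm_imp_triangle_on:
  assumes H: "bipartite_graph X Y E" and fin: "finite I" "finite J"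
    and semi: "seminorm_on (W_H X Y E I J) (norm_H X Y E I J)"
  shows "triangle_on UNIV X Y E I J"
  unfolding triangle_on_def
proof (intro allI impI)
  fix u w :: "'b \<times> 'c \<Rightarrow> real"
  have "norm_H X Y E I J (\<lambda>p. zero_ext I J u p + zero_ext I J w p)
      \<le> norm_H X Y E I J (zero_ext I J u) + norm_H X Y E I J (zero_ext I J w)"
    using semi zero_ext_in_W_H[OF H fin] unfolding seminorm_on_def by blast
  moreover have "norm_H X Y E I J (\<lambda>p. zero_ext I J u p + zero_ext I J w p)
      = norm_H X Y E I J (\<lambda>p. u p + w p)"
    by (rule norm_H_weights_cong[OF H]) (simp add: zero_ext_def)
  ultimately show "norm_H X Y E I J (\<lambda>p. u p + w p) \<le> norm_H X Y E I J u + norm_H X Y E I J w"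
    by (simp add: norm_H_zero_ext[OF H])
qed

lemma norm_imp_triangle_on:
  assumes H: "bipartite_graph X Y E" and fin: "finite I" "finite J"
    and norm: "norm_on (W_rH X Y E I J) (norm_rH X Y E I J)"
  shows "triangle_on {0..} X Y E I J"
  unfolding triangle_on_def
proof (intro allI impI)
  fix u w :: "'b \<times> 'c \<Rightarrow> real"
  assume u: "\<forall>p. u p \<in> {0..}" and w: "\<forall>p. w p \<in> {0..}"
  have eq: "norm_rH X Y E I J (\<lambda>p. zero_ext I J h p) = norm_H X Y E I J h"
    if "\<forall>p. h p \<in> {0..}" for h
    unfolding norm_rH_eq_norm_H using that
    by (intro norm_H_weights_cong[OF H]) (auto simp: zero_ext_def)
  have "norm_rH X Y E I J (\<lambda>p. zero_ext I J u p + zero_ext I J w p)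
      \<le> norm_rH X Y E I J (zero_ext I J u) + norm_rH X Y E I J (zero_ext I J w)"
    using norm zero_ext_in_W_H[OF H fin]
    unfolding norm_on_def seminorm_on_def W_rH_eq_W_H by blast
  moreover have "norm_rH X Y E I J (\<lambda>p. zero_ext I J u p + zero_ext I J w p)
      = norm_H X Y E I J (\<lambda>p. u p + w p)"
    unfolding norm_rH_eq_norm_H using u w
    by (intro norm_H_weights_cong[OF H]) (auto simp: zero_ext_def)
  ultimately show "norm_H X Y E I J (\<lambda>p. u p + w p) \<le> norm_H X Y E I J u + norm_H X Y E I J w"
    by (simp add: eq[OF u] eq[OF w])
qed

text \<open>The Hoelder properties pass through finite sets of natural numbers, which changes the index types
from \<open>'i\<close>, \<open>'j\<close> to \<open>'k\<close>, \<open>'l\<close> in one direction. In the other direction the triangle inequality is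
carried from \<open>'k\<close>, \<open>'l\<close> to finite sets of natural numbers, where tensor squares are available.\<close>
theorem theorem2p8:
  fixes X Y :: "'v set" and E :: "('v \<times> 'v) multiset"
  assumes "bipartite_graph X Y E" and "E \<noteq> {#}"
  shows "(hoelder TYPE('i::infinite) TYPE('j::infinite) X Y E \<longleftrightarrow>
            (\<forall>(I :: 'k::infinite set) (J :: 'l::infinite set).
               seminorm_on (W_H X Y E I J) (norm_H X Y E I J))) \<and>
         (weakly_hoelder TYPE('i) TYPE('j) X Y E \<longleftrightarrow>
            (\<forall>(I :: 'k set) (J :: 'l set).
               norm_on (W_rH X Y E I J) (norm_rH X Y E I J)))"
proof (intro conjI iffI allI)
  note hoelder_finite = hoelder_iff_finite[OF assms]
    and weakly_hoelder_finite = weakly_hoelder_iff_finite[OF assms]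
  show "seminorm_on (W_H X Y E I J) (norm_H X Y E I J)"
    if "hoelder TYPE('i) TYPE('j) X Y E" for I :: "'k set" and J :: "'l set"
  proof -
    have "hoelder TYPE('k) TYPE('l) X Y E"
      using that unfolding hoelder_finite .
    then show ?thesis by (rule hoelder_imp_seminorm[OF assms(2)])
  qed
  show "norm_on (W_rH X Y E I J) (norm_rH X Y E I J)"
    if "weakly_hoelder TYPE('i) TYPE('j) X Y E" for I :: "'k set" and J :: "'l set"
  proof -
    have "weakly_hoelder TYPE('k) TYPE('l) X Y E"
      using that unfolding weakly_hoelder_finite .
    then show ?thesis by (rule weakly_hoelder_imp_norm[OF assms])
  qed
  show "hoelder TYPE('i) TYPE('j) X Y E"
    if semi: "\<forall>(I :: 'k set) (J :: 'l set). seminorm_on (W_H X Y E I J) (norm_H X Y E I J)"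
  proof -
    have "triangle_on UNIV X Y E I J" if "finite I" "finite J" for I J :: "nat set"
      by (rule triangle_on_transfer[OF assms(1) that])
        (use semi in \<open>blast intro: seminorm_imp_triangle_on[OF assms(1)]\<close>)
    then show ?thesis
      unfolding hoelder_finite
      by (intro allI impI triangle_imp_hoelder_on_nat[OF assms]) (auto simp: nonneg_semiring_def)
  qed
  show "weakly_hoelder TYPE('i) TYPE('j) X Y E"
    if norm: "\<forall>(I :: 'k set) (J :: 'l set). norm_on (W_rH X Y E I J) (norm_rH X Y E I J)"
  proof -
    have "triangle_on {0..} X Y E I J" if "finite I" "finite J" for I J :: "nat set"
      by (rule triangle_on_transfer[OF assms(1) that])
        (use norm in \<open>blast intro: norm_imp_triangle_on[OF assms(1)]\<close>)
    then show ?thesis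
      unfolding weakly_hoelder_finite
      by (intro allI impI triangle_imp_hoelder_on_nat[OF assms]) (auto simp: nonneg_semiring_def)
  qed
qed

end
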